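(* Let $b,c,\nu,\rho\in\mathbb{C}$ with $c\neq1$, $\operatorname{Re}(\nu)>-1$ and $\operatorname{Re}(\rho)>0$, and let $z\in\mathbb{C}\setminus(-\infty,0]$. Then $$\frac{\partial}{\partial\rho}\big[G_\nu^{(b,c)}(z;\rho)\big]=-\frac{1}{c-1}\,G_\nu^{(b,c-1)}(z;\rho).$$
   Context: For $\rho\in\mathbb{C}$ with $\operatorname{Re}(\rho)>0$ and $x\in\mathbb{C}$ put $\Gamma_\rho(x)=\int_0^\infty t^{x-1}e^{-t-\rho/t}\,dt$. The generalized Pochhammer symbol is $(\lambda;\rho)_\nu:=\Gamma_\rho(\lambda+\nu)/\Gamma(\lambda)$ for $\lambda,\nu\in\mathbb{C}$, where $1/\Gamma$ is read as an entire function (zero at $0,-1,-2,\dots$). The unified four parameter Bessel function is $$G_\nu^{(b,c)}(z;\rho):=\sum_{k=0}^\infty \frac{(-b)^k (c;\rho)_{2k+\nu}}{\Gamma(\nu+k+1)\,\Gamma(\nu+2k+1)}\,\frac{(z/2)^{2k+\nu}}{k!}.$$ Complex powers are principal. *)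

theory Defs
  imports "HOL-Analysis.Analysis"
begin

text \<open>
  The three functions below are meaningful for \<open>Re \<rho> > 0\<close>, where the integral converges
  absolutely for every complex \<open>x\<close>; elsewhere their values carry no meaning.
\<close>

definition Gamma_reg :: "complex \<Rightarrow> complex \<Rightarrow> complex" where
  "Gamma_reg \<rho> x =
     (LINT t:{0<..}|lborel. complex_of_real t powr (x - 1) * exp (- complex_of_real t - \<rho> / complex_of_real t))"

text \<open>\<open>rGamma\<close> is the entire function \<open>1 / \<Gamma>\<close>, vanishing at \<open>0, -1, -2, \<dots>\<close>.\<close>

definition gen_pochhammer :: "complex \<Rightarrow> complex \<Rightarrow> complex \<Rightarrow> complex" where
  "gen_pochhammer l \<rho> \<nu> = Gamma_reg \<rho> (l + \<nu>) * rGamma l"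

definition unified_Bessel :: "complex \<Rightarrow> complex \<Rightarrow> complex \<Rightarrow> complex \<Rightarrow> complex \<Rightarrow> complex" where
  "unified_Bessel \<nu> b c z \<rho> =
     (\<Sum>k. (- b) ^ k * gen_pochhammer c \<rho> (2 * of_nat k + \<nu>)
            / (Gamma (\<nu> + of_nat k + 1) * Gamma (\<nu> + 2 * of_nat k + 1))
            * ((z / 2) powr (2 * of_nat k + \<nu>) / fact k))"

end

theory Submission
  imports Defs "HOL-Real_Asymp.Real_Asymp"
begin

text \<open>
  Differentiating the kernel \<open>t powr (x - 1) * exp (- t - \<rho> / t)\<close> in \<open>\<rho>\<close> multiplies it by \<open>- 1 / t\<close>,
  which lowers \<open>x\<close> by one. So formally the derivative of \<open>Gamma_reg \<rho> x\<close> is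
  \<open>- Gamma_reg \<rho> (x - 1)\<close>, and termwise differentiation of the Bessel series replaces \<open>c\<close> by
  \<open>c - 1\<close> inside \<open>Gamma_reg\<close>. The factor \<open>1 / (c - 1)\<close> comes from the other half of the Pochhammer
  symbol: \<open>rGamma (c - 1) = (c - 1) * rGamma c\<close>, an identity that holds at the zeros of \<open>rGamma\<close> too.

  Both interchanges of limits, with the integral and with the sum, are replaced by a single
  quadratic estimate. On the half plane \<open>Re \<rho> \<ge> r > 0\<close> the second derivative of the kernel in \<open>\<rho>\<close>
  is dominated by \<open>t powr (Re x - 3) * exp (- t - r / t)\<close>, so the error of the linear approximation
  of \<open>Gamma_reg\<close> at \<open>\<rho>\<close> is at most \<open>norm (\<rho>' - \<rho>) ^ 2\<close> times the integral of that majorant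
  (\<open>Gamma_reg_linear_remainder_le\<close>). Such a bound can be summed over the series as it stands. All
  that remains is convergence of the majorant series: since \<open>exp (- r / t)\<close> beats every power
  of \<open>t\<close> at \<open>0\<close>, the majorant integral with exponent shifted by \<open>2 k\<close> is \<open>O((N + 2 k)!)\<close> for
  some \<open>N\<close> (\<open>regularized_gamma_majorant\<close>). The factorial is offset, up to a power of \<open>k\<close>, by
  \<open>\<Gamma>(\<nu> + 2 k + 1)\<close>, and \<open>\<Gamma>(\<nu> + k + 1) k!\<close> supplies the convergence
  (\<open>summable_bessel_weight_times_fact\<close>).
\<close>

section \<open>A majorant for the regularized Gamma integral\<close>

text \<open>
  For \<open>t \<ge> 1\<close> the exponential is at most \<open>1\<close> and \<open>N \<ge> \<bar>s\<bar>\<close> suffices. For \<open>t < 1\<close> a single term of the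
  exponential series gives \<open>exp (- r / t) \<le> (2 N)! (t / r) ^ (2 N)\<close>, which turns the
  worst case \<open>t powr (- N)\<close> into \<open>t ^ N\<close>.
\<close>

lemma powr_times_exp_neg_inverse_le_power:
  fixes r s :: real
  assumes "r > 0"
  obtains C :: real and N :: nat
    where "C > 0" and "\<And>t. t > 0 \<Longrightarrow> t powr s * exp (- (r / t)) \<le> C * t ^ N"
proof -
  define N where "N = nat \<lceil>\<bar>s\<bar>\<rceil>"
  have N: "\<bar>s\<bar> \<le> real N" unfolding N_def by linarith
  define A :: real where "A = fact (2 * N) / r ^ (2 * N)"
  have A: "A > 0" using assms by (simp add: A_def)
  have "t powr s * exp (- (r / t)) \<le> max 1 A * t ^ N" if t: "t > 0" for t
  proof (cases "t \<ge> 1")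
    case True
    have "t powr s * exp (- (r / t)) \<le> t powr s * 1"
      using assms t by (intro mult_left_mono) auto
    also have "\<dots> \<le> t powr real N" using True N by (simp add: powr_mono)
    also have "\<dots> = 1 * t ^ N" using t by (simp add: powr_realpow)
    also have "\<dots> \<le> max 1 A * t ^ N" using t by (intro mult_right_mono) auto
    finally show ?thesis .
  next
    case False
    have "(r / t) ^ (2 * N) / fact (2 * N) \<le> exp (r / t)"
    proof -
      have "(\<Sum>k\<in>{2*N}. (r / t) ^ k / fact k) \<le> (\<Sum>k. (r / t) ^ k / fact k)"
        using assms t summable_exp[of "r / t"]
        by (intro sum_le_suminf) (auto simp: field_simps)
      thus ?thesis by (simp add: exp_def field_simps scaleR_conv_of_real)
    qed
    hence "exp (- (r / t)) \<le> A * t ^ (2 * N)"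
      using assms t by (simp add: A_def exp_minus field_simps power_divide)
    moreover have "t powr s \<le> t powr (- real N)"
      using False N t by (intro powr_mono') auto
    ultimately have "t powr s * exp (- (r / t)) \<le> t powr (- real N) * (A * t ^ (2 * N))"
      by (intro mult_mono) auto
    also have "\<dots> = A * t ^ N"
    proof -
      have "t ^ (2 * N) = t ^ N * t ^ N" by (simp add: mult_2 power_add)
      thus ?thesis using t by (simp only: powr_minus powr_realpow) simp
    qed
    also have "\<dots> \<le> max 1 A * t ^ N" using t by (intro mult_right_mono) auto
    finally show ?thesis .
  qed
  thus ?thesis using that[of "max 1 A" N] by simp
qed

lemma
  shows set_integrable_power_times_exp: "set_integrable lborel {0<..} (\<lambda>t::real. t ^ n * exp (- t))"
    and set_integral_power_times_exp: "(LINT t:{0<..}|lborel. t ^ n * exp (- t)) = (fact n :: real)"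
proof -
  have "has_bochner_integral lborel (\<lambda>t::real. indicator {0<..} t *\<^sub>R (t ^ n * exp (- t))) (fact n)"
  proof (rule has_bochner_integral_nn_integral)
    have "(\<integral>\<^sup>+t. ennreal (indicator {0<..} t *\<^sub>R (t ^ n * exp (- t))) \<partial>lborel)
        = (\<integral>\<^sup>+t. ennreal (indicator {0..} t * t powr (real (Suc n) - 1) / exp t) \<partial>lborel)"
      using AE_lborel_singleton[of "0::real"]
      by (intro nn_integral_cong_AE)
         (auto elim!: eventually_mono simp: indicator_def powr_realpow exp_minus field_simps)
    also have "\<dots> = ennreal (Gamma (real (Suc n)))"
      by (subst Gamma_conv_nn_integral_real) auto
    finally show "(\<integral>\<^sup>+t. ennreal (indicator {0<..} t *\<^sub>R (t ^ n * exp (- t))) \<partial>lborel)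
        = ennreal (fact n)" using Gamma_fact[of n, where 'a = real] by (simp add: add_ac)
  qed (auto simp: indicator_def)
  thus "set_integrable lborel {0<..} (\<lambda>t::real. t ^ n * exp (- t))"
    and "(LINT t:{0<..}|lborel. t ^ n * exp (- t)) = (fact n :: real)"
    by (auto simp: set_integrable_def set_lebesgue_integral_def has_bochner_integral_iff)
qed

text \<open>
  The constants \<open>C\<close> and \<open>N\<close> do not depend on the shift \<open>m\<close>, which makes the bound
  usable along the whole Bessel series. It reduces to Euler's integral for \<open>(N + m)!\<close>.
\<close>

lemma regularized_gamma_majorant:
  fixes r s :: real
  assumes "r > 0"
  obtains C :: real and N :: nat
    where "C > 0"
      and "\<And>m::nat. set_integrable lborel {0<..} (\<lambda>t. t powr (s + m) * exp (- t - r / t))"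
      and "\<And>m::nat. (LINT t:{0<..}|lborel. t powr (s + m) * exp (- t - r / t)) \<le> C * fact (N + m)"
proof -
  obtain C N where C: "C > 0" and
    bound: "\<And>t. t > 0 \<Longrightarrow> t powr s * exp (- (r / t)) \<le> C * t ^ N"
    using powr_times_exp_neg_inverse_le_power[OF assms] by blast
  have le: "t powr (s + m) * exp (- t - r / t) \<le> C * (t ^ (N + m) * exp (- t))"
    if "t > 0" for t and m :: nat
  proof -
    have "t powr (s + m) * exp (- t - r / t) = (t powr s * exp (- (r / t))) * (t ^ m * exp (- t))"
    proof -
      have "exp (- t - r / t) = exp (- t) * exp (- (r / t))" by (simp flip: exp_add)
      thus ?thesis using that by (simp only: powr_add powr_realpow) simp
    qed
    also have "\<dots> \<le> (C * t ^ N) * (t ^ m * exp (- t))"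
      using that bound by (intro mult_right_mono) auto
    finally show ?thesis by (simp add: power_add mult_ac)
  qed
  have int: "set_integrable lborel {0<..} (\<lambda>t. C * (t ^ (N + m) * exp (- t)))" for m
    using set_integrable_power_times_exp by (intro set_integrable_mult_right)
  have int': "set_integrable lborel {0<..} (\<lambda>t. t powr (s + m) * exp (- t - r / t))" for m :: nat
  proof (rule set_integrable_bound[OF int[of m]])
    show "set_borel_measurable lborel {0<..} (\<lambda>t. t powr (s + m) * exp (- t - r / t))"
      unfolding set_borel_measurable_def by measurable
    show "AE t in lborel. t \<in> {0<..} \<longrightarrow> norm (t powr (s + m) * exp (- t - r / t))
            \<le> norm (C * (t ^ (N + m) * exp (- t)))"
      using le C by (intro AE_I2) (auto simp: abs_mult)
  qed
  have "(LINT t:{0<..}|lborel. t powr (s + m) * exp (- t - r / t)) \<le> C * fact (N + m)" for m :: nat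
  proof -
    have "(LINT t:{0<..}|lborel. t powr (s + m) * exp (- t - r / t))
        \<le> (LINT t:{0<..}|lborel. C * (t ^ (N + m) * exp (- t)))"
      using le int int' by (intro set_integral_mono) auto
    thus ?thesis by (simp add: set_integral_power_times_exp)
  qed
  with that[OF C int'] show ?thesis by blast
qed

lemma regularized_gamma_majorant_integrable:
  fixes r s :: real
  assumes "r > 0"
  shows "set_integrable lborel {0<..} (\<lambda>t. t powr s * exp (- t - r / t))"
proof -
  obtain C N where "\<And>m::nat. set_integrable lborel {0<..} (\<lambda>t. t powr (s + m) * exp (- t - r / t))"
    using regularized_gamma_majorant[OF assms, of s] by metis
  from this[of 0] show ?thesis by simp
qed

section \<open>Linear approximation in the regularization parameter\<close>

lemma norm_Gamma_reg_kernel: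
  fixes x \<rho> :: complex
  assumes "t > 0"
  shows "norm (complex_of_real t powr (x - 1) * exp (- complex_of_real t - \<rho> / complex_of_real t))
       = t powr (Re x - 1) * exp (- t - Re \<rho> / t)"
proof -
  have "Re (\<rho> / of_real t) = Re \<rho> / t" by simp
  thus ?thesis using assms by (simp add: norm_mult norm_powr_real_powr)
qed

lemma Gamma_reg_kernel_integrable:
  fixes x \<rho> :: complex
  assumes "Re \<rho> > 0"
  shows "set_integrable lborel {0<..}
    (\<lambda>t. complex_of_real t powr (x - 1) * exp (- complex_of_real t - \<rho> / complex_of_real t))"
proof (rule set_integrable_bound)
  show "set_integrable lborel {0<..} (\<lambda>t. t powr (Re x - 1) * exp (- t - Re \<rho> / t))"
    by (rule regularized_gamma_majorant_integrable) fact
  have "continuous_on {0<..}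
      (\<lambda>t. complex_of_real t powr (x - 1) * exp (- complex_of_real t - \<rho> / complex_of_real t))"
    by (auto intro!: continuous_intros)
  from set_measurable_continuous_on[OF _ this] show "set_borel_measurable lborel {0<..}
      (\<lambda>t. complex_of_real t powr (x - 1) * exp (- complex_of_real t - \<rho> / complex_of_real t))"
    by (simp add: set_borel_measurable_def)
qed (auto simp: norm_Gamma_reg_kernel intro!: AE_I2)

text \<open>
  Taylor's theorem on the half plane \<open>Re z \<le> m\<close>, which is convex and on which \<open>exp m\<close> bounds
  the second derivative of \<open>exp\<close>.
\<close>

lemma norm_exp_linear_remainder_le:
  fixes a b :: complex
  assumes "Re a \<le> m" "Re b \<le> m"
  shows "norm (exp b - exp a - (b - a) * exp a) \<le> exp m * norm (b - a) ^ 2"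
proof -
  have "norm (exp b - (\<Sum>i\<le>1. exp a * (b - a) ^ i / fact i)) \<le> exp m * norm (b - a) ^ Suc 1 / fact 1"
    by (rule complex_Taylor[of "{z. Re z \<le> m}" 1 "\<lambda>_. exp"])
       (use assms in \<open>auto intro!: convex_halfspace_Re_le derivative_eq_intros\<close>)
  thus ?thesis by (simp add: power2_eq_square algebra_simps)
qed

text \<open>
  The estimate behind the theorem: \<open>- Gamma_reg \<rho> (x - 1)\<close> is the derivative of \<open>Gamma_reg\<close> in the
  parameter, with an explicit quadratic error. Pointwise in \<open>t\<close> it is the Taylor bound for \<open>exp\<close>
  between \<open>- \<rho> / t\<close> and \<open>- \<rho>' / t\<close>, whose squared distance contributes the factor
  \<open>1 / t ^ 2\<close> that turns the exponent \<open>Re x - 1\<close> into \<open>Re x - 3\<close>.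
\<close>

lemma Gamma_reg_linear_remainder_le:
  fixes x \<rho> \<rho>' :: complex
  assumes "r > 0" "r \<le> Re \<rho>" "r \<le> Re \<rho>'"
  shows "norm (Gamma_reg \<rho>' x - Gamma_reg \<rho> x + (\<rho>' - \<rho>) * Gamma_reg \<rho> (x - 1))
       \<le> norm (\<rho>' - \<rho>) ^ 2 * (LINT t:{0<..}|lborel. t powr (Re x - 3) * exp (- t - r / t))"
proof -
  define K where "K = (\<lambda>\<rho> x t. complex_of_real t powr (x - 1) * exp (- complex_of_real t - \<rho> / complex_of_real t))"
  have Kint: "set_integrable lborel {0<..} (K p y)" if "r \<le> Re p" for p y
    unfolding K_def using that assms(1) by (intro Gamma_reg_kernel_integrable) auto
  define R where "R = (\<lambda>t. K \<rho>' x t - K \<rho> x t + (\<rho>' - \<rho>) * K \<rho> (x - 1) t)"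
  have Rint: "set_integrable lborel {0<..} R"
    unfolding R_def using assms Kint by (intro set_integral_add set_integral_diff set_integrable_mult_right)
  have eq: "Gamma_reg \<rho>' x - Gamma_reg \<rho> x + (\<rho>' - \<rho>) * Gamma_reg \<rho> (x - 1) = (LINT t:{0<..}|lborel. R t)"
  proof -
    have G: "Gamma_reg p y = (LINT t:{0<..}|lborel. K p y t)" for p y
      by (simp add: Gamma_reg_def K_def)
    have "(LINT t:{0<..}|lborel. R t) = (LINT t:{0<..}|lborel. K \<rho>' x t - K \<rho> x t)
        + (LINT t:{0<..}|lborel. (\<rho>' - \<rho>) * K \<rho> (x - 1) t)"
      unfolding R_def using assms Kint
      by (intro set_integral_add set_integral_diff set_integrable_mult_right) auto
    also have "(LINT t:{0<..}|lborel. K \<rho>' x t - K \<rho> x t)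
        = (LINT t:{0<..}|lborel. K \<rho>' x t) - (LINT t:{0<..}|lborel. K \<rho> x t)"
      using assms Kint by (intro set_integral_diff) auto
    finally show ?thesis by (simp add: G)
  qed
  have bound: "norm (R t) \<le> norm (\<rho>' - \<rho>) ^ 2 * (t powr (Re x - 3) * exp (- t - r / t))" if t: "t > 0" for t
  proof -
    define a b where "a = - (\<rho> / of_real t)" and "b = - (\<rho>' / of_real t)"
    have ba: "b - a = - ((\<rho>' - \<rho>) / of_real t)" by (simp add: a_def b_def diff_divide_distrib)
    have shift: "of_real t powr (x - 1 - 1) = of_real t powr (x - 1) / complex_of_real t"
      using t by (subst powr_diff) auto
    have "R t = of_real t powr (x - 1) * exp (- of_real t) * (exp b - exp a - (b - a) * exp a)"
    proof -
      have "exp (- of_real t - p / of_real t) = exp (- complex_of_real t) * exp (- (p / of_real t))" for p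
        by (simp flip: exp_add)
      thus ?thesis
        unfolding R_def K_def shift ba using t
        by (simp only: a_def[symmetric] b_def[symmetric]) (simp add: field_simps)
    qed
    hence "norm (R t) = t powr (Re x - 1) * exp (- t) * norm (exp b - exp a - (b - a) * exp a)"
      using t by (simp add: norm_mult norm_powr_real_powr)
    also have "\<dots> \<le> t powr (Re x - 1) * exp (- t) * (exp (- (r / t)) * norm (b - a) ^ 2)"
      using t assms
      by (intro mult_left_mono norm_exp_linear_remainder_le) (auto simp: a_def b_def divide_right_mono)
    also have "\<dots> = norm (\<rho>' - \<rho>) ^ 2 * (t powr (Re x - 1 - 2) * exp (- t - r / t))"
    proof -
      have "exp (- t - r / t) = exp (- t) * exp (- (r / t))" by (simp flip: exp_add)
      moreover have "t powr (Re x - 1 - 2) = t powr (Re x - 1) / t ^ 2"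
        using t by (simp only: powr_diff) simp
      ultimately show ?thesis unfolding ba using t
        by (simp only: norm_minus_cancel norm_divide power_divide) simp
    qed
    finally show ?thesis by simp
  qed
  have "norm (LINT t:{0<..}|lborel. R t) \<le> (LINT t:{0<..}|lborel. norm (R t))"
    using Rint by (rule set_integral_norm_bound)
  also have "\<dots> \<le> (LINT t:{0<..}|lborel. norm (\<rho>' - \<rho>) ^ 2 * (t powr (Re x - 3) * exp (- t - r / t)))"
    using bound assms(1) Rint
    by (intro set_integral_mono set_integrable_norm set_integrable_mult_right
          regularized_gamma_majorant_integrable) auto
  finally show ?thesis by (simp add: eq)
qed

section \<open>Convergence of the Bessel series\<close>

text \<open>
  The part of the \<open>k\<close>-th term of the Bessel series free of \<open>c\<close> and \<open>\<rho>\<close>; the series for \<open>c\<close> and for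
  \<open>c - 1\<close> share it.
\<close>

definition bessel_weight :: "complex \<Rightarrow> complex \<Rightarrow> complex \<Rightarrow> nat \<Rightarrow> complex" where
  "bessel_weight \<nu> b z k =
     (- b) ^ k * (z / 2) powr (2 * of_nat k + \<nu>)
       / (Gamma (\<nu> + of_nat k + 1) * Gamma (\<nu> + 2 * of_nat k + 1) * fact k)"

lemma bessel_weight_Suc:
  assumes "Re \<nu> > -1" "z \<noteq> 0"
  shows "bessel_weight \<nu> b z (Suc k) = bessel_weight \<nu> b z k * (- b) * (z / 2)\<^sup>2
    / ((\<nu> + of_nat k + 1) * (\<nu> + 2 * of_nat k + 1) * (\<nu> + 2 * of_nat k + 2) * of_nat (Suc k))"
proof -
  have ni: "\<nu> + of_nat j + 1 \<notin> \<int>\<^sub>\<le>\<^sub>0" for j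
  proof
    assume "\<nu> + of_nat j + 1 \<in> \<int>\<^sub>\<le>\<^sub>0"
    then obtain n where "\<nu> + of_nat j + 1 = - of_nat n" by (auto elim: nonpos_Ints_cases')
    hence "Re (\<nu> + of_nat j + 1) = - real n" by simp
    with assms(1) show False by simp
  qed
  have G: "Gamma (\<nu> + of_nat (Suc j) + 1) = (\<nu> + of_nat j + 1) * Gamma (\<nu> + of_nat j + 1)" for j
    using Gamma_plus1[OF ni[of j]] by (simp add: add_ac)
  have G1: "Gamma (\<nu> + of_nat (Suc k) + 1) = (\<nu> + of_nat k + 1) * Gamma (\<nu> + of_nat k + 1)"
    by (rule G)
  have G2: "Gamma (\<nu> + 2 * of_nat (Suc k) + 1)
      = (\<nu> + 2 * of_nat k + 2) * ((\<nu> + 2 * of_nat k + 1) * Gamma (\<nu> + 2 * of_nat k + 1))"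
    using G[of "Suc (2 * k)"] G[of "2 * k"] by (simp add: algebra_simps)
  have p: "(z / 2) powr (2 * of_nat (Suc k) + \<nu>) = (z / 2) powr (2 * of_nat k + \<nu>) * (z / 2)\<^sup>2"
  proof -
    have "2 * of_nat (Suc k) + \<nu> = (2 * of_nat k + \<nu>) + of_nat 2" by simp
    thus ?thesis using assms(2) by (simp only: powr_add powr_nat') simp
  qed
  show ?thesis
    unfolding bessel_weight_def p G1 G2 by (simp add: field_simps)
qed

text \<open>
  Ratio test. Since \<open>Re \<nu> > -1\<close>, every factor \<open>\<nu> + j\<close> in the denominator of the ratio has norm at
  least \<open>j - 1\<close>, so the ratio is at most an explicit rational function \<open>q\<close> of \<open>k\<close> whose
  numerator has degree \<open>2\<close> and whose denominator has degree \<open>4\<close>.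
\<close>

lemma summable_bessel_weight_times_fact:
  assumes "Re \<nu> > -1" "z \<noteq> 0"
  shows "summable (\<lambda>k. norm (bessel_weight \<nu> b z k) * fact (N + 2 * k))"
proof -
  define X where "X = norm b * norm (z / 2) ^ 2"
  define q where "q = (\<lambda>k::nat. X * (real N + 2 * k + 1) * (real N + 2 * k + 2) / (real k * (2 * k) * (2 * k + 1) * (k + 1)))"
  have "q \<longlonglongrightarrow> 0" unfolding q_def by real_asymp
  hence "eventually (\<lambda>k. q k < 1 / 2) sequentially" by (rule order_tendstoD) simp
  then obtain K where K: "\<And>k. k \<ge> K \<Longrightarrow> q k < 1 / 2" by (auto simp: eventually_at_top_linorder)
  show ?thesis
  \<comment> \<open>The bound \<open>q\<close> has a pole at \<open>k = 0\<close>, so the comparison starts at \<open>1\<close>.\<close>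
  proof (rule summable_ratio_test[of "1 / 2" "max 1 K"])
    fix k assume k: "k \<ge> max 1 K"
    have lower: "norm (\<nu> + of_real y) \<ge> y - 1" for y
      using complex_Re_le_cmod[of "\<nu> + of_real y"] assms(1) by simp
    have l1: "norm (\<nu> + of_nat k + 1) \<ge> k"
      using lower[of "real k + 1"] by (simp add: add_ac)
    have l2: "norm (\<nu> + 2 * of_nat k + 1) \<ge> 2 * k"
      using lower[of "2 * real k + 1"] by (simp add: add_ac)
    have l3: "norm (\<nu> + 2 * of_nat k + 2) \<ge> 2 * k + 1"
      using lower[of "2 * real k + 2"] by (simp add: add_ac)
    let ?D = "norm (\<nu> + of_nat k + 1) * norm (\<nu> + 2 * of_nat k + 1) * norm (\<nu> + 2 * of_nat k + 2) * (k + 1)"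
    have D: "real k * (2 * k) * (2 * k + 1) * (k + 1) \<le> ?D"
      using l1 l2 l3 by (intro mult_mono) auto
    have norm_Suc: "norm (of_nat (Suc k) :: complex) = real k + 1"
      by (simp only: norm_of_nat)
    have f: "fact (N + 2 * Suc k) = (real N + 2 * k + 1) * (real N + 2 * k + 2) * fact (N + 2 * k)"
      by (simp add: algebra_simps)
    have "norm (bessel_weight \<nu> b z (Suc k)) * fact (N + 2 * Suc k)
        = (X * (real N + 2 * k + 1) * (real N + 2 * k + 2) / ?D)
            * (norm (bessel_weight \<nu> b z k) * fact (N + 2 * k))"
      unfolding bessel_weight_Suc[OF assms] f X_def
      by (simp add: norm_mult norm_divide norm_power norm_Suc del: of_nat_Suc)
    also have "\<dots> \<le> q k * (norm (bessel_weight \<nu> b z k) * fact (N + 2 * k))"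
    proof (intro mult_right_mono)
      have pos: "0 < real k * (2 * k) * (2 * k + 1) * (k + 1)" using k by simp
      show "X * (real N + 2 * k + 1) * (real N + 2 * k + 2) / ?D \<le> q k"
        unfolding q_def
        by (rule divide_left_mono[OF D _ mult_pos_pos[OF less_le_trans[OF pos D] pos]])
           (simp add: X_def)
    qed simp
    also have "\<dots> \<le> 1 / 2 * (norm (bessel_weight \<nu> b z k) * fact (N + 2 * k))"
      using K[of k] k by (intro mult_right_mono) auto
    finally show "norm (norm (bessel_weight \<nu> b z (Suc k)) * fact (N + 2 * Suc k))
        \<le> 1 / 2 * norm (norm (bessel_weight \<nu> b z k) * fact (N + 2 * k))" by simp
  qed simp
qed

lemma summable_bessel_weight_times_majorant:
  fixes s r :: real
  assumes "Re \<nu> > -1" "z \<noteq> 0" "r > 0"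
  shows "summable (\<lambda>k. norm (bessel_weight \<nu> b z k)
           * (LINT t:{0<..}|lborel. t powr (s + real (2 * k)) * exp (- t - r / t)))"
proof -
  obtain C N where C: "C > 0" and
    le: "\<And>m::nat. (LINT t:{0<..}|lborel. t powr (s + m) * exp (- t - r / t)) \<le> C * fact (N + m)"
    using regularized_gamma_majorant[OF assms(3), of s] by metis
  have nonneg: "0 \<le> (LINT t:{0<..}|lborel. t powr (s + m) * exp (- t - r / t))" for m :: nat
    unfolding set_lebesgue_integral_def by (intro integral_nonneg_AE) auto
  show ?thesis
  proof (rule summable_comparison_test'[where N = 0])
    show "summable (\<lambda>k. C * (norm (bessel_weight \<nu> b z k) * fact (N + 2 * k)))"
      using summable_bessel_weight_times_fact assms by (intro summable_mult)
    show "norm (norm (bessel_weight \<nu> b z k)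
           * (LINT t:{0<..}|lborel. t powr (s + real (2 * k)) * exp (- t - r / t)))
        \<le> C * (norm (bessel_weight \<nu> b z k) * fact (N + 2 * k))" for k
      using mult_left_mono[OF le[of "2 * k"], of "norm (bessel_weight \<nu> b z k)"] nonneg[of "2 * k"]
      by (simp add: abs_mult mult_ac)
  qed
qed

lemma norm_Gamma_reg_le:
  assumes "Re \<rho> > 0"
  shows "norm (Gamma_reg \<rho> x) \<le> (LINT t:{0<..}|lborel. t powr (Re x - 1) * exp (- t - Re \<rho> / t))"
proof -
  have "norm (Gamma_reg \<rho> x) \<le> (LINT t:{0<..}|lborel. norm (complex_of_real t powr (x - 1)
           * exp (- complex_of_real t - \<rho> / complex_of_real t)))"
    unfolding Gamma_reg_def using assms by (intro set_integral_norm_bound Gamma_reg_kernel_integrable)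
  also have "\<dots> = (LINT t:{0<..}|lborel. t powr (Re x - 1) * exp (- t - Re \<rho> / t))"
    by (intro set_lebesgue_integral_cong) (auto simp: norm_Gamma_reg_kernel)
  finally show ?thesis .
qed

lemma summable_bessel_weight_times_Gamma_reg:
  assumes "Re \<nu> > -1" "z \<noteq> 0" "Re \<rho> > 0"
  shows "summable (\<lambda>k. bessel_weight \<nu> b z k * Gamma_reg \<rho> (x + of_nat (2 * k)))"
proof (rule summable_comparison_test'[where N = 0])
  show "summable (\<lambda>k. norm (bessel_weight \<nu> b z k)
      * (LINT t:{0<..}|lborel. t powr (Re x - 1 + real (2 * k)) * exp (- t - Re \<rho> / t)))"
    by (intro summable_bessel_weight_times_majorant assms)
  show "norm (bessel_weight \<nu> b z k * Gamma_reg \<rho> (x + of_nat (2 * k)))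
      \<le> norm (bessel_weight \<nu> b z k)
        * (LINT t:{0<..}|lborel. t powr (Re x - 1 + real (2 * k)) * exp (- t - Re \<rho> / t))" for k
    using mult_left_mono[OF norm_Gamma_reg_le[OF assms(3), of "x + of_nat (2 * k)"], of "norm (bessel_weight \<nu> b z k)"]
    by (simp add: norm_mult algebra_simps)
qed

section \<open>Differentiation of the series\<close>

lemma has_field_derivative_quadratic_remainder:
  fixes f :: "'a::real_normed_field \<Rightarrow> 'a"
  assumes "e > 0"
    and "\<And>y. dist y x < e \<Longrightarrow> norm (f y - f x - (y - x) * D) \<le> K * norm (y - x) ^ 2"
  shows "(f has_field_derivative D) (at x)"
proof -
  have "((\<lambda>y. (f y - f x) / (y - x) - D) \<longlongrightarrow> 0) (at x)"
  proof (rule Lim_null_comparison)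
    show "eventually (\<lambda>y. norm ((f y - f x) / (y - x) - D) \<le> K * norm (y - x)) (at x)"
      unfolding eventually_at
    proof (intro exI conjI ballI impI)
      fix y assume y: "y \<noteq> x \<and> dist y x < e"
      have "(f y - f x) / (y - x) - D = (f y - f x - (y - x) * D) / (y - x)"
        using y by (simp add: field_simps)
      thus "norm ((f y - f x) / (y - x) - D) \<le> K * norm (y - x)"
        using y assms(2)[of y] by (simp add: norm_divide divide_le_eq power2_eq_square mult_ac)
    qed fact
    show "((\<lambda>y. K * norm (y - x)) \<longlongrightarrow> 0) (at x)" by (auto intro!: tendsto_eq_intros)
  qed
  thus ?thesis by (simp add: has_field_derivative_iff LIM_zero_iff)
qed

text \<open>
  The linear approximations of the terms are summed together with their errors. Near \<open>\<rho>\<close>, where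
  the real part stays above \<open>Re \<rho> / 2\<close>, all errors share the factor
  \<open>norm (p - \<rho>) ^ 2\<close>, and its coefficients form a convergent series.
\<close>

lemma bessel_series_has_field_derivative:
  assumes "Re \<nu> > -1" "z \<noteq> 0" "Re \<rho> > 0"
  shows "((\<lambda>\<rho>. \<Sum>k. bessel_weight \<nu> b z k * Gamma_reg \<rho> (x + of_nat (2 * k))) has_field_derivative
           - (\<Sum>k. bessel_weight \<nu> b z k * Gamma_reg \<rho> (x - 1 + of_nat (2 * k)))) (at \<rho>)"
proof -
  define a where "a = bessel_weight \<nu> b z"
  define F where "F = (\<lambda>\<rho> x. \<Sum>k. a k * Gamma_reg \<rho> (x + of_nat (2 * k)))"
  define r where "r = Re \<rho> / 2"
  have r: "r > 0" using assms by (simp add: r_def)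
  define J where "J = (\<lambda>k::nat. LINT t:{0<..}|lborel. t powr (Re x - 3 + real (2 * k)) * exp (- t - r / t))"
  have J: "summable (\<lambda>k. norm (a k) * J k)"
    unfolding J_def a_def by (intro summable_bessel_weight_times_majorant assms r)
  have S: "summable (\<lambda>k. a k * Gamma_reg p (y + of_nat (2 * k)))" if "Re p > 0" for p y
    unfolding a_def by (intro summable_bessel_weight_times_Gamma_reg assms that)
  have "((\<lambda>\<rho>. F \<rho> x) has_field_derivative - F \<rho> (x - 1)) (at \<rho>)"
  proof (rule has_field_derivative_quadratic_remainder[OF r, where K = "\<Sum>k. norm (a k) * J k"])
    fix p assume "dist p \<rho> < r"
    hence "\<bar>Re (p - \<rho>)\<bar> < r" using abs_Re_le_cmod[of "p - \<rho>"] by (simp add: dist_norm)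
    hence p: "r \<le> Re p" "r \<le> Re \<rho>" using r by (auto simp: r_def abs_if split: if_splits)
    have pos: "Re p > 0" "Re \<rho> > 0" using p r by auto
    define R where "R = (\<lambda>k. a k * (Gamma_reg p (x + of_nat (2 * k)) - Gamma_reg \<rho> (x + of_nat (2 * k))
        + (p - \<rho>) * Gamma_reg \<rho> (x - 1 + of_nat (2 * k))))"
    have R_le: "norm (R k) \<le> norm (p - \<rho>) ^ 2 * (norm (a k) * J k)" for k
      using mult_left_mono[OF Gamma_reg_linear_remainder_le[OF r p(2,1), of "x + of_nat (2 * k)"], of "norm (a k)"]
      unfolding R_def norm_mult by (simp add: J_def algebra_simps)
    have "R sums (F p x - F \<rho> x + (p - \<rho>) * F \<rho> (x - 1))"
    proof -
      have "(\<lambda>k. a k * Gamma_reg p (x + of_nat (2 * k)) - a k * Gamma_reg \<rho> (x + of_nat (2 * k))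
              + (p - \<rho>) * (a k * Gamma_reg \<rho> (x - 1 + of_nat (2 * k))))
            sums (F p x - F \<rho> x + (p - \<rho>) * F \<rho> (x - 1))"
        unfolding F_def by (intro sums_add sums_diff sums_mult summable_sums S pos)
      thus ?thesis by (simp add: R_def algebra_simps)
    qed
    hence "F p x - F \<rho> x - (p - \<rho>) * - F \<rho> (x - 1) = suminf R" by (simp add: sums_iff)
    also have "norm (suminf R) \<le> (\<Sum>k. norm (p - \<rho>) ^ 2 * (norm (a k) * J k))"
    proof -
      have majorant: "summable (\<lambda>k. norm (p - \<rho>) ^ 2 * (norm (a k) * J k))"
        by (intro summable_mult J)
      have "summable (\<lambda>k. norm (R k))"
        using R_le by (intro summable_comparison_test'[OF majorant, where N = 0]) auto
      thus ?thesis using summable_norm suminf_le[OF R_le _ majorant] by (blast intro: order_trans)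
    qed
    also have "\<dots> = (\<Sum>k. norm (a k) * J k) * norm (p - \<rho>) ^ 2"
      by (subst suminf_mult[OF J]) (rule mult.commute)
    finally show "norm (F p x - F \<rho> x - (p - \<rho>) * - F \<rho> (x - 1))
        \<le> (\<Sum>k. norm (a k) * J k) * norm (p - \<rho>) ^ 2" .
  qed
  thus ?thesis by (simp add: F_def a_def)
qed

lemma unified_Bessel_conv_bessel_weight:
  "unified_Bessel \<nu> b c z \<rho>
     = (\<Sum>k. rGamma c * (bessel_weight \<nu> b z k * Gamma_reg \<rho> (c + \<nu> + of_nat (2 * k))))"
  unfolding unified_Bessel_def bessel_weight_def gen_pochhammer_def
  by (intro suminf_cong) (simp add: add_ac)

theorem theorem3p3:
  fixes b c \<nu> \<rho> z :: complex
  assumes "c \<noteq> 1" and "Re \<nu> > -1" and "Re \<rho> > 0" and "z \<notin> \<real>\<^sub>\<le>\<^sub>0"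
  shows "((\<lambda>\<rho>. unified_Bessel \<nu> b c z \<rho>) has_field_derivative
            - (1 / (c - 1)) * unified_Bessel \<nu> b (c - 1) z \<rho>) (at \<rho>)"
proof -
  have z: "z \<noteq> 0" using assms(4) by auto
  define F where "F = (\<lambda>\<rho> x. \<Sum>k. bessel_weight \<nu> b z k * Gamma_reg \<rho> (x + of_nat (2 * k)))"
  have eq: "unified_Bessel \<nu> b l z p = rGamma l * F p (l + \<nu>)" if "Re p > 0" for l p
    unfolding unified_Bessel_conv_bessel_weight F_def
    by (intro suminf_mult summable_bessel_weight_times_Gamma_reg assms z that)
  have "((\<lambda>\<rho>. rGamma c * F \<rho> (c + \<nu>)) has_field_derivative rGamma c * - F \<rho> (c + \<nu> - 1)) (at \<rho>)"
    unfolding F_def by (intro DERIV_cmult bessel_series_has_field_derivative assms z)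
  also have "rGamma c * - F \<rho> (c + \<nu> - 1) = - (1 / (c - 1)) * unified_Bessel \<nu> b (c - 1) z \<rho>"
  proof -
    have "rGamma (c - 1) = (c - 1) * rGamma c" using rGamma_plus1[of "c - 1"] by simp
    moreover have "c + \<nu> - 1 = c - 1 + \<nu>" by simp
    ultimately show ?thesis using assms(1) by (simp only: eq[OF assms(3)]) simp
  qed
  \<comment> \<open>The factor \<open>rGamma c\<close> comes out of the series only where the series is known to converge,
      that is for positive real part; an open set around \<open>\<rho>\<close> is enough.\<close>
  finally show ?thesis
  proof (rule has_field_derivative_transform_within_open)
    show "open {p. Re p > 0}" by (rule open_halfspace_Re_gt)
  qed (use assms eq in auto)
qed

end
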